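(* Assume (A1)-(A5) (see context) hold on the local region $(\Omega,V)$, where $V\subset\mathbb{R}^{N\times d}$ is an open ball centred at $Y^*$, and that the iterates satisfy $\theta_k\in\Omega$ for all $k\ge 0$ almost surely. Suppose $F$ is strongly convex on $V$ with constant $c_Y>0$, i.e. $F(Y')\ge F(Y)+\langle\nabla_YF(Y),Y'-Y\rangle+\frac{c_Y}{2}\|Y'-Y\|_{\mathrm F}^2$ for all $Y,Y'\in V$, where $Y^*$ is the minimum point of $F$. Let $c_2=\frac12(LB_1^2+B_0B_2)B_1^2$ and $c_3=\frac{b}{N}\lambda_{\min}-c_2\eta$. If the fixed step size $\eta>0$ satisfies $$\eta<\min\left\{\frac{b}{N}\cdot\frac{\lambda_{\min}}{c_2},\ \frac{1}{2c_3c_Y}\right\},$$ then there exist constants $C>0$ and $\rho\in(0,1)$ such that for all $k\ge 0$ $$\mathbb{E}[F(Y(\theta_k))]-F(Y^* )\le C\rho^k,$$ where the expectation is over the batches $\mathcal B_0,\dots,\mathcal B_{k-1}$.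
   Context: Setting. $N,d,s\ge1$ are integers; $Y:\mathbb{R}^s\to\mathbb{R}^{N\times d}$ is $C^2$ (its $n$-th row $Y_n(\theta)$ is the output on sample $n$) and $F:\mathbb{R}^{N\times d}\to\mathbb{R}$ is $C^1$. $\nabla_YF(Y)\in\mathbb{R}^{N\times d}$ is the gradient, with $n$-th row $(\nabla_YF)_n$ (a row vector in $\mathbb{R}^d$). $\nabla_\theta Y_n(\theta)\in\mathbb{R}^{d\times s}$ is the Jacobian of $Y_n$, and $\nabla_\theta Y(\theta)\in\mathbb{R}^{Nd\times s}$ is the vertical concatenation of the $\nabla_\theta Y_n(\theta)$. $\nabla_\theta^2Y$ is the tensor of second derivatives. $\|\cdot\|_{\mathrm F}$ is the Frobenius norm (Euclidean norm of all entries). Algorithm (ideal per-batch gradient). Starting from a deterministic $\theta_0\in\mathbb{R}^s$, at each step $k$ a random batch $\mathcal B_k\subset\{1,\dots,N\}$ of fixed size $b=|\mathcal B_k|$ is drawn, independently of the past, with every index belonging to $\mathcal B_k$ with probability $b/N$. Set $G_k=\sum_{n\in\mathcal B_k}(\nabla_YF(Y(\theta_k)))_n\,\nabla_\theta Y_n(\theta_k)\in\mathbb{R}^{1\times s}$ and $\theta_{k+1}=\theta_k-\eta G_k^\top$, with fixed step size $\eta>0$. Local region and assumptions. $\Omega\subset\mathbb{R}^s$ is an open convex set and $V\subset\mathbb{R}^{N\times d}$ is a convex set with $Y(\Omega)\subset V$. There are positive constants $B_0,L,B_1,B_2,\lambda_{\min}$ such that: (A1) $\|\nabla_YF(Y)\|_{\mathrm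 F}\le B_0$ for $Y\in V$; (A2) $\|\nabla_YF(Y)-\nabla_YF(Y')\|_{\mathrm F}\le L\|Y-Y'\|_{\mathrm F}$ for $Y,Y'\in V$; (A3) $\|\nabla_\theta Y(\theta)\|_{\mathrm F}\le B_1$ for $\theta\in\Omega$; (A4) $\|\nabla_\theta^2Y(\theta)\|_{\mathrm F}\le B_2$ for $\theta\in\Omega$; (A5) the smallest eigenvalue of $\nabla_\theta Y(\theta)\nabla_\theta Y(\theta)^\top\in\mathbb{R}^{Nd\times Nd}$ is at least $\lambda_{\min}>0$ for $\theta\in\Omega$. *)

theory Defs
  imports "HOL-Probability.Probability"
begin

text \<open>
  Matrices with \<open>N\<close> rows and \<open>d\<close> columns are elements of \<open>real^'d^'n\<close>, with
  \<open>N = CARD('n)\<close>, \<open>d = CARD('d)\<close>.  The library norm and inner product on iterated \<open>vec\<close> types are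
  the Euclidean ones of all entries, so that \<open>norm\<close> is the Frobenius norm for matrices
  and for third-order tensors alike.  The \<open>n\<close>-th row of \<open>X\<close> is \<open>X $ n\<close>.
\<close>

definition gradient :: "('a::real_inner \<Rightarrow> real) \<Rightarrow> 'a \<Rightarrow> 'a" where
  "gradient f x = (THE D. gderiv f x D)"

definition C1_function :: "('a::real_inner \<Rightarrow> real) \<Rightarrow> bool" where
  "C1_function f \<longleftrightarrow> (\<forall>x. \<exists>D. gderiv f x D) \<and> continuous_on UNIV (gradient f)"

definition row_jacobian :: "(real^'s \<Rightarrow> real^'d^'n) \<Rightarrow> 'n \<Rightarrow> real^'s \<Rightarrow> real^'s^'d" where
  "row_jacobian Y n \<theta> = jacobian (\<lambda>t. Y t $ n) (at \<theta>)"

text \<open>The \<open>Nd \<times> s\<close> vertical concatenation of the row Jacobians; its rows are indexed by pairs.\<close>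

definition full_jacobian :: "(real^'s \<Rightarrow> real^'d^'n) \<Rightarrow> real^'s \<Rightarrow> real^'s^('n \<times> 'd)" where
  "full_jacobian Y \<theta> = (\<chi> p. row_jacobian Y (fst p) \<theta> $ snd p)"

text \<open>
  For each output entry \<open>p = (n, j)\<close>, the row \<open>full_jacobian Y t $ p\<close> is the gradient of that
  entry, so its Jacobian is the Hessian matrix of that entry.
\<close>

definition second_derivative ::
  "(real^'s \<Rightarrow> real^'d^'n) \<Rightarrow> real^'s \<Rightarrow> real^'s^'s^('n \<times> 'd)" where
  "second_derivative Y \<theta> = (\<chi> p. jacobian (\<lambda>t. full_jacobian Y t $ p) (at \<theta>))"

definition C2_function :: "(real^'s \<Rightarrow> real^'d^'n) \<Rightarrow> bool" where
  "C2_function Y \<longleftrightarrow>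
     (\<forall>\<theta>. Y differentiable (at \<theta>)) \<and>
     (\<forall>\<theta>. full_jacobian Y differentiable (at \<theta>)) \<and>
     continuous_on UNIV (second_derivative Y)"

text \<open>
  Meaningful for symmetric matrices, whose real eigenvalues form a finite nonempty set; it is
  only used for Gram matrices.
\<close>

definition smallest_eigenvalue :: "real^'m^'m \<Rightarrow> real" where
  "smallest_eigenvalue A = Min {l. \<exists>v. v \<noteq> 0 \<and> A *v v = l *\<^sub>R v}"

definition batch_gradient ::
  "(real^'d^'n \<Rightarrow> real) \<Rightarrow> (real^'s \<Rightarrow> real^'d^'n) \<Rightarrow> 'n set \<Rightarrow> real^'s \<Rightarrow> real^'s" where
  "batch_gradient F Y S \<theta> = (\<Sum>n\<in>S. (gradient F (Y \<theta>) $ n) v* row_jacobian Y n \<theta>)"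

primrec sgd_iterate ::
  "(real^'d^'n \<Rightarrow> real) \<Rightarrow> (real^'s \<Rightarrow> real^'d^'n) \<Rightarrow> real \<Rightarrow> real^'s \<Rightarrow>
   (nat \<Rightarrow> 'w \<Rightarrow> 'n set) \<Rightarrow> nat \<Rightarrow> 'w \<Rightarrow> real^'s" where
  "sgd_iterate F Y \<eta> \<theta>0 \<B> 0 \<omega> = \<theta>0"
| "sgd_iterate F Y \<eta> \<theta>0 \<B> (Suc k) \<omega> =
     sgd_iterate F Y \<eta> \<theta>0 \<B> k \<omega> -
       \<eta> *\<^sub>R batch_gradient F Y (\<B> k \<omega>) (sgd_iterate F Y \<eta> \<theta>0 \<B> k \<omega>)"

text \<open>
  The batches at different steps are mutually independent, which expresses that each is drawn
  independently of the past; they need not be identically distributed.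
\<close>

definition random_batches :: "'w measure \<Rightarrow> nat \<Rightarrow> (nat \<Rightarrow> 'w \<Rightarrow> 'n::finite set) \<Rightarrow> bool" where
  "random_batches M b \<B> \<longleftrightarrow>
     prob_space.indep_vars M (\<lambda>_. count_space UNIV) \<B> UNIV \<and>
     (\<forall>k. \<forall>\<omega>\<in>space M. card (\<B> k \<omega>) = b) \<and>
     (\<forall>k n. measure M {\<omega> \<in> space M. n \<in> \<B> k \<omega>} = real b / real CARD('n))"

end

theory Submission
  imports Defs
begin

text \<open>
  On \<open>\<Omega>\<close> the gradient \<open>\<nabla>F J\<close> of \<open>F \<circ> Y\<close>, with \<open>J\<close> the full Jacobian of \<open>Y\<close>, is Lipschitz with
  constant \<open>L B1\<^sup>2 + B0 B2\<close>, so one step changes \<open>F \<circ> Y\<close> by at most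
  \<open>- \<eta> \<langle>\<nabla>F J, G\<rangle> + c2 \<eta>\<^sup>2 \<parallel>\<nabla>F\<parallel>\<^sup>2\<close>.  The batch is independent of the current iterate, hence the
  mean of the inner product is \<open>b/N\<close> times that of \<open>\<parallel>\<nabla>F J\<parallel>\<^sup>2 \<ge> lambda_min \<parallel>\<nabla>F\<parallel>\<^sup>2\<close>.  Strong
  convexity gives \<open>\<parallel>\<nabla>F\<parallel>\<^sup>2 \<ge> 2 c_Y (F - F Ystar)\<close>, so the expected gap contracts by the factor
  \<open>1 - 2 \<eta> c3 c_Y\<close> at each step.
\<close>

section \<open>Frobenius norms and the smallest eigenvalue\<close>

lemma norm_matrix_vector_mult_le:
  fixes A :: "real^'a^'b"
  shows "norm (A *v x) \<le> norm A * norm x"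
proof -
  have "norm (A *v x) \<le> L2_set (\<lambda>i. norm (A $ i) * norm x) UNIV"
    unfolding norm_vec_def[of "A *v x"]
    by (intro L2_set_mono) (simp_all add: matrix_vector_mul_component Cauchy_Schwarz_ineq2)
  also have "\<dots> = norm A * norm x"
    by (simp add: norm_vec_def[of A] L2_set_left_distrib)
  finally show ?thesis .
qed

text \<open>The adjoint relation rewrites the squared norm as
  \<open>x \<bullet> (A *v (x v* A))\<close>. The bound for \<open>*v\<close> then applies, and one
  factor \<open>norm (x v* A)\<close> cancels.\<close>

lemma norm_vector_matrix_mult_le:
  fixes A :: "real^'a^'b"
  shows "norm (x v* A) \<le> norm x * norm A"
proof (cases "norm (x v* A) = 0")
  case False
  have "(norm (x v* A))\<^sup>2 = x \<bullet> (A *v (x v* A))"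
    by (simp add: power2_norm_eq_inner dot_lmul_matrix)
  also have "\<dots> \<le> norm x * (norm A * norm (x v* A))"
    by (meson norm_cauchy_schwarz norm_matrix_vector_mult_le mult_left_mono norm_ge_zero order_trans)
  finally have "norm (x v* A) * norm (x v* A) \<le> (norm x * norm A) * norm (x v* A)"
    by (simp add: power2_eq_square mult_ac)
  then show ?thesis
    using False by (simp add: mult_le_cancel_right)
qed simp

text \<open>Meant for the derivative of the full Jacobian: its \<open>p\<close>-th row in direction
  \<open>h\<close> is the Hessian of entry \<open>p\<close> applied to \<open>h\<close>, and the row
  bounds combine in the Euclidean sense.\<close>

lemma norm_le_norm_tensor:
  fixes T :: "real^'a^'b^'c"
  assumes "\<And>p. v $ p = T $ p *v h"
  shows "norm v \<le> norm T * norm h"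
proof -
  have "norm v \<le> L2_set (\<lambda>p. norm (T $ p) * norm h) UNIV"
    unfolding norm_vec_def[of v]
    by (intro L2_set_mono) (simp_all add: assms norm_matrix_vector_mult_le)
  also have "\<dots> = norm T * norm h"
    by (simp add: norm_vec_def[of T] L2_set_left_distrib)
  finally show ?thesis .
qed

section \<open>Spectra of symmetric matrices and the Rayleigh bound\<close>

lemma symmetric_inner:
  fixes A :: "real^'m^'m"
  assumes "transpose A = A"
  shows "(A *v x) \<bullet> y = x \<bullet> (A *v y)"
  by (metis assms dot_lmul_matrix vector_transpose_matrix)

text \<open>Makes the \<open>Min\<close> in \<open>smallest_eigenvalue\<close> meaningful. Choosing
  one eigenvector per eigenvalue gives nonzero, pairwise orthogonal, hence independent vectors, and
  there are only finitely many of those.\<close>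

lemma finite_eigenvalues_symmetric:
  fixes A :: "real^'m^'m"
  assumes sym: "transpose A = A"
  shows "finite {l. \<exists>v. v \<noteq> 0 \<and> A *v v = l *\<^sub>R v}" (is "finite ?E")
proof -
  define v where "v l = (SOME v. v \<noteq> 0 \<and> A *v v = l *\<^sub>R v)" for l
  have v: "v l \<noteq> 0" "A *v v l = l *\<^sub>R v l" if "l \<in> ?E" for l
    using someI_ex[of "\<lambda>v. v \<noteq> 0 \<and> A *v v = l *\<^sub>R v"] that unfolding v_def by auto
  have inj: "inj_on v ?E"
  proof (rule inj_onI)
    fix l l' assume l: "l \<in> ?E" "l' \<in> ?E" "v l = v l'"
    have "l *\<^sub>R v l = l' *\<^sub>R v l"
      using v(2)[OF l(1)] v(2)[OF l(2)] l(3) by metis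
    then show "l = l'"
      using v(1)[OF l(1)] by simp
  qed
  have "orthogonal (v l) (v l')" if "l \<in> ?E" "l' \<in> ?E" "l \<noteq> l'" for l l'
  proof -
    have "l * (v l \<bullet> v l') = l' * (v l \<bullet> v l')"
      using symmetric_inner[OF sym, of "v l" "v l'"] v(2)[OF that(1)] v(2)[OF that(2)]
      by simp
    then show ?thesis using that(3) by (simp add: orthogonal_def)
  qed
  then have "pairwise orthogonal (v ` ?E)"
    by (auto simp: pairwise_def)
  moreover have "0 \<notin> v ` ?E"
    using v(1) by force
  ultimately have "independent (v ` ?E)"
    by (rule pairwise_orthogonal_independent)
  then have "finite (v ` ?E)"
    by (rule independent_imp_finite)
  then show ?thesis
    using inj finite_image_iff by blast
qed

text \<open>
  A vector minimising a nonnegative quadratic form lies in the kernel of its matrix: moving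
  from \<open>v\<close> in the direction \<open>- B v\<close> would otherwise make the form negative.
\<close>

lemma psd_kernel:
  fixes B :: "real^'m^'m"
  assumes sym: "transpose B = B" and psd: "\<And>x. x \<bullet> (B *v x) \<ge> 0" and v: "v \<bullet> (B *v v) = 0"
  shows "B *v v = 0"
proof (rule ccontr)
  assume "B *v v \<noteq> 0"
  define w where "w = B *v v"
  define a where "a = w \<bullet> w"
  define c where "c = w \<bullet> (B *v w)"
  \<comment> \<open>The \<open>+ 1\<close> keeps the denominator positive when \<open>c = 0\<close>
    and still gives \<open>- (t * c) \<le> a\<close>, so the linear term wins.\<close>
  define t where "t = - a / (c + 1)"
  have a: "a > 0" and c: "c \<ge> 0"
    using \<open>B *v v \<noteq> 0\<close> psd by (auto simp: a_def c_def w_def)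
  have "v \<bullet> (B *v w) = a"
    using symmetric_inner[OF sym, of v w] by (simp add: a_def w_def)
  then have "(v + t *\<^sub>R w) \<bullet> (B *v (v + t *\<^sub>R w)) = 2 * t * a + t * t * c"
    using v by (simp add: matrix_vector_right_distrib matrix_vector_mult_scaleR inner_add_left
        inner_add_right a_def c_def algebra_simps flip: w_def)
  then have "0 \<le> 2 * t * a + t * t * c"
    using psd by metis
  also have "\<dots> = t * (2 * a + t * c)"
    by (simp add: algebra_simps)
  also have "\<dots> < 0"
  proof (rule mult_neg_pos)
    show "t < 0"
      using a c by (simp add: t_def)
    have "- (t * c) \<le> a"
      using a c by (simp add: t_def field_simps)
    then show "2 * a + t * c > 0"
      using a by simp
  qed
  finally show False by simp
qed

text \<open>The minimum \<open>m\<close> of the quadratic form on the unit sphere is itself an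
  eigenvalue: \<open>A - m I\<close> is positive semidefinite and its form vanishes at the
  minimiser, so \<open>psd_kernel\<close> applies. Hence the smallest eigenvalue is at most
  \<open>m\<close>.\<close>

lemma smallest_eigenvalue_le_rayleigh:
  fixes A :: "real^'m^'m"
  assumes sym: "transpose A = A"
  shows "smallest_eigenvalue A * (norm x)\<^sup>2 \<le> x \<bullet> (A *v x)"
proof -
  have "continuous_on (sphere 0 1) (\<lambda>x. x \<bullet> (A *v x))"
    by (intro continuous_intros linear_continuous_on matrix_vector_mul_bounded_linear)
  moreover have "sphere (0::real^'m) 1 \<noteq> {}"
    by simp
  ultimately obtain v :: "real^'m" where v: "norm v = 1"
    and min: "\<And>y. norm y = 1 \<Longrightarrow> v \<bullet> (A *v v) \<le> y \<bullet> (A *v y)"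
    using continuous_attains_inf[of "sphere (0::real^'m) 1" "\<lambda>x. x \<bullet> (A *v x)"]
    by auto
  define m where "m = v \<bullet> (A *v v)"
  have ray: "m * (norm x)\<^sup>2 \<le> x \<bullet> (A *v x)" for x
  proof (cases "x = 0")
    case False
    have "m \<le> (x /\<^sub>R norm x) \<bullet> (A *v (x /\<^sub>R norm x))"
      using min[of "x /\<^sub>R norm x"] False by (simp add: m_def)
    also have "\<dots> = (x \<bullet> (A *v x)) / (norm x)\<^sup>2"
      by (simp add: matrix_vector_mult_scaleR power2_eq_square divide_inverse mult_ac)
    finally show ?thesis
      using False by (simp add: field_simps)
  qed simp
  define B where "B = A - m *\<^sub>R mat 1"
  have B: "B *v x = A *v x - m *\<^sub>R x" for x
    by (simp add: B_def matrix_vector_mult_diff_rdistrib scaleR_matrix_vector_assoc[symmetric])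
  have "transpose B = B"
    using sym by (simp add: B_def transpose_def vec_eq_iff mat_def)
  moreover have "x \<bullet> (B *v x) \<ge> 0" for x
    using ray[of x] by (simp add: B inner_diff_right power2_norm_eq_inner)
  moreover have "v \<bullet> (B *v v) = 0"
    using v by (simp add: B inner_diff_right m_def norm_eq_1)
  ultimately have "B *v v = 0"
    by (rule psd_kernel)
  then have "A *v v = m *\<^sub>R v"
    by (simp add: B)
  moreover have "v \<noteq> 0"
    using v by auto
  ultimately have "smallest_eigenvalue A \<le> m"
    unfolding smallest_eigenvalue_def
    by (intro Min_le finite_eigenvalues_symmetric[OF sym]) auto
  then show ?thesis
    using ray[of x] by (meson mult_right_mono order_trans zero_le_power2)
qed

text \<open>Turns the eigenvalue bound (A5) into a lower bound for the parameter gradient in terms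
  of the output gradient, since \<open>x \<bullet> (J J^T x)\<close> is the squared norm of
  \<open>x v* J\<close>.\<close>

lemma smallest_eigenvalue_gram_le:
  fixes J :: "real^'s^'m"
  shows "smallest_eigenvalue (J ** transpose J) * (norm x)\<^sup>2 \<le> (norm (x v* J))\<^sup>2"
proof -
  have "transpose (J ** transpose J) = J ** transpose J"
    by (simp add: matrix_transpose_mul)
  from smallest_eigenvalue_le_rayleigh[OF this, of x] show ?thesis
    by (simp add: power2_norm_eq_inner dot_lmul_matrix flip: matrix_vector_mul_assoc)
qed


section \<open>Gradients and Jacobians\<close>

lemma gderiv_unique:
  assumes "GDERIV f x :> D" "GDERIV f x :> E"
  shows "D = E"
proof -
  have "(\<lambda>h. h \<bullet> D) = (\<lambda>h. h \<bullet> E)"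
    using assms unfolding gderiv_def by (rule has_derivative_unique)
  then have "h \<bullet> D = h \<bullet> E" for h
    by (rule fun_cong)
  then show ?thesis
    by (rule vector_eq_ldot[THEN iffD1, OF allI])
qed

lemma C1_function_has_derivative:
  assumes "C1_function F"
  shows "(F has_derivative (\<lambda>h. gradient F x \<bullet> h)) (at x)"
proof -
  obtain D where D: "GDERIV F x :> D"
    using assms by (auto simp: C1_function_def)
  then have "gradient F x = D"
    unfolding gradient_def by (blast intro: gderiv_unique)
  with D show ?thesis
    by (simp add: gderiv_def inner_commute)
qed

text \<open>The isometry from output matrices to vectors indexed by pairs, the index type of the
  rows of \<open>full_jacobian\<close>.\<close>

definition flatten :: "real^'d^'n \<Rightarrow> real^('n \<times> 'd)" where
  "flatten X = (\<chi> p. X $ fst p $ snd p)"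

lemma inner_flatten: "flatten X \<bullet> flatten Z = X \<bullet> Z"
  by (simp add: flatten_def inner_vec_def sum.cartesian_product case_prod_beta)

lemma norm_flatten [simp]: "norm (flatten X) = norm X"
  by (simp add: norm_eq_sqrt_inner inner_flatten)

lemma flatten_diff: "flatten (X - Z) = flatten X - flatten Z"
  by (simp add: flatten_def vec_eq_iff)

text \<open>Used twice: with \<open>g = Y\<close> for the row Jacobians, and with
  \<open>g = full_jacobian Y\<close> for the Hessians of the output entries.\<close>

lemma jacobian_component:
  fixes g :: "real^'s \<Rightarrow> real^'b^'c"
  assumes "(g has_derivative D) (at x)"
  shows "jacobian (\<lambda>t. g t $ p) (at x) *v h = D h $ p"
proof -
  have "((\<lambda>t. g t $ p) has_derivative (\<lambda>h. D h $ p)) (at x)"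
    using assms by (rule bounded_linear.has_derivative[OF bounded_linear_vec_nth])
  moreover from this have "((\<lambda>t. g t $ p) has_derivative (*v) (jacobian (\<lambda>t. g t $ p) (at x))) (at x)"
    unfolding jacobian_works[symmetric] differentiable_def by blast
  ultimately show ?thesis
    by (metis has_derivative_unique)
qed

lemma C2_function_has_derivative:
  assumes "C2_function Y"
  obtains D where "(Y has_derivative D) (at \<theta>)" "\<And>h. flatten (D h) = full_jacobian Y \<theta> *v h"
proof -
  obtain D where D: "(Y has_derivative D) (at \<theta>)"
    using assms by (auto simp: C2_function_def differentiable_def)
  have "flatten (D h) = full_jacobian Y \<theta> *v h" for h
    using jacobian_component[OF D, of _ h]
    by (simp add: vec_eq_iff flatten_def full_jacobian_def row_jacobian_def
        matrix_vector_mul_component)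
  with D that show ?thesis by blast
qed

lemma full_jacobian_has_derivative:
  assumes "C2_function Y"
  obtains D where "(full_jacobian Y has_derivative D) (at \<theta>)"
    "\<And>h. norm (D h) \<le> norm (second_derivative Y \<theta>) * norm h"
proof -
  obtain D where D: "(full_jacobian Y has_derivative D) (at \<theta>)"
    using assms by (auto simp: C2_function_def differentiable_def)
  have "norm (D h) \<le> norm (second_derivative Y \<theta>) * norm h" for h
    by (rule norm_le_norm_tensor) (simp add: second_derivative_def jacobian_component[OF D])
  with D that show ?thesis by blast
qed

section \<open>Mean value estimates and strong convexity\<close>

lemma lipschitz_of_derivative_bound:
  fixes f :: "'a::{real_normed_vector, perfect_space} \<Rightarrow> 'b::real_normed_vector"
  assumes "convex S" "x \<in> S" "y \<in> S"
    and "\<And>z. z \<in> S \<Longrightarrow> \<exists>D. (f has_derivative D) (at z) \<and> (\<forall>h. norm (D h) \<le> K * norm h)"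
  shows "norm (f x - f y) \<le> K * norm (x - y)"
proof -
  obtain D where D: "\<And>z. z \<in> S \<Longrightarrow> (f has_derivative D z) (at z)"
      "\<And>z h. z \<in> S \<Longrightarrow> norm (D z h) \<le> K * norm h"
    using assms(4) by metis
  show ?thesis
    using assms(1)
  proof (rule differentiable_bound)
    show "(f has_derivative D z) (at z within S)" if "z \<in> S" for z
      using D(1)[OF that] by (rule has_derivative_at_withinI)
    show "onorm (D z) \<le> K" if "z \<in> S" for z
      by (rule onorm_le) (rule D(2)[OF that])
  qed (use assms in auto)
qed

text \<open>The descent lemma. Only gradient differences against the base point \<open>x\<close>
  occur along the segment from \<open>x\<close> to \<open>y\<close>, so \<open>lip\<close> compares
  with \<open>g x\<close> alone.\<close>

lemma lipschitz_gradient_upper_bound: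
  fixes f :: "'a::real_inner \<Rightarrow> real"
  assumes S: "convex S" "x \<in> S" "y \<in> S"
    and der: "\<And>z. z \<in> S \<Longrightarrow> (f has_derivative (\<lambda>h. g z \<bullet> h)) (at z)"
    and lip: "\<And>z. z \<in> S \<Longrightarrow> norm (g z - g x) \<le> K * norm (z - x)"
  shows "f y \<le> f x + g x \<bullet> (y - x) + K / 2 * (norm (y - x))\<^sup>2"
proof -
  define h where "h = y - x"
  \<comment> \<open>Subtracting the linear and quadratic terms along the segment makes \<phi>
    nonincreasing, and comparing its endpoint values is the claim.\<close>
  define \<phi> where "\<phi> t = f (x + t *\<^sub>R h) - t * (g x \<bullet> h) - K / 2 * t\<^sup>2 * (norm h)\<^sup>2" for t
  have "\<phi> 1 \<le> \<phi> 0"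
  proof (rule DERIV_nonpos_imp_nonincreasing[of 0 1 \<phi>])
    fix t :: real assume t: "0 \<le> t" "t \<le> 1"
    have in_S: "x + t *\<^sub>R h \<in> S"
      using convexD_alt[OF S t] by (simp add: h_def algebra_simps)
    have "((\<lambda>t. f (x + t *\<^sub>R h)) has_derivative (\<lambda>s. g (x + t *\<^sub>R h) \<bullet> (s *\<^sub>R h))) (at t)"
      by (rule has_derivative_compose[where f = "\<lambda>t. x + t *\<^sub>R h", OF _ der[OF in_S]])
        (auto intro!: derivative_eq_intros)
    then have "((\<lambda>t. f (x + t *\<^sub>R h)) has_field_derivative g (x + t *\<^sub>R h) \<bullet> h) (at t)"
      by (simp add: has_field_derivative_def mult_commute_abs)
    then have "(\<phi> has_field_derivative g (x + t *\<^sub>R h) \<bullet> h - g x \<bullet> h - K * t * (norm h)\<^sup>2) (at t)"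
      unfolding \<phi>_def by (auto intro!: derivative_eq_intros)
    moreover have "g (x + t *\<^sub>R h) \<bullet> h - g x \<bullet> h \<le> K * t * (norm h)\<^sup>2"
    proof -
      have "g (x + t *\<^sub>R h) \<bullet> h - g x \<bullet> h \<le> norm (g (x + t *\<^sub>R h) - g x) * norm h"
        by (metis inner_diff_left norm_cauchy_schwarz)
      also have "\<dots> \<le> (K * norm (t *\<^sub>R h)) * norm h"
        using lip[OF in_S] by (intro mult_right_mono) auto
      finally show ?thesis
        using t by (simp add: power2_eq_square mult_ac)
    qed
    ultimately show "\<exists>l. (\<phi> has_field_derivative l) (at t) \<and> l \<le> 0"
      by force
  qed simp
  then show ?thesis
    by (simp add: \<phi>_def h_def)
qed

text \<open>The Polyak-Lojasiewicz inequality, by completing the square. It is applied with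
  \<open>z\<close> the displacement from the current output to \<open>Ystar\<close>.\<close>

lemma strongly_convex_imp_gradient_dominated:
  fixes g :: "'a::real_inner"
  assumes "c > 0" and "fs \<ge> f + g \<bullet> z + c / 2 * (norm z)\<^sup>2"
  shows "2 * c * (f - fs) \<le> (norm g)\<^sup>2"
proof -
  have "0 \<le> (norm (g + c *\<^sub>R z))\<^sup>2"
    by simp
  also have "\<dots> = (norm g)\<^sup>2 + 2 * c * (g \<bullet> z + c / 2 * (norm z)\<^sup>2)"
    by (simp add: power2_norm_eq_inner inner_add_left inner_add_right inner_commute[of z g]
        algebra_simps)
  also have "\<dots> \<le> (norm g)\<^sup>2 + 2 * c * (fs - f)"
    using assms by (intro add_left_mono mult_left_mono) auto
  finally show ?thesis
    by (simp add: algebra_simps)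
qed


section \<open>One step of the algorithm\<close>

text \<open>By the chain rule this is the gradient of \<open>F\<close> composed with
  \<open>Y\<close>, as \<open>compose_has_derivative\<close> confirms.\<close>

definition full_gradient ::
  "(real^'d^'n \<Rightarrow> real) \<Rightarrow> (real^'s \<Rightarrow> real^'d^'n) \<Rightarrow> real^'s \<Rightarrow> real^'s" where
  "full_gradient F Y \<theta> = flatten (gradient F (Y \<theta>)) v* full_jacobian Y \<theta>"

lemma compose_has_derivative:
  assumes "C1_function F" "C2_function Y"
  shows "((\<lambda>\<theta>. F (Y \<theta>)) has_derivative (\<lambda>h. full_gradient F Y \<theta> \<bullet> h)) (at \<theta>)"
proof -
  obtain D where D: "(Y has_derivative D) (at \<theta>)" "\<And>h. flatten (D h) = full_jacobian Y \<theta> *v h"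
    using C2_function_has_derivative[OF assms(2)] by blast
  have "((\<lambda>\<theta>. F (Y \<theta>)) has_derivative (\<lambda>h. gradient F (Y \<theta>) \<bullet> D h)) (at \<theta>)"
    by (rule has_derivative_compose[OF D(1) C1_function_has_derivative[OF assms(1)]])
  moreover have "gradient F (Y \<theta>) \<bullet> D h = full_gradient F Y \<theta> \<bullet> h" for h
    by (simp add: full_gradient_def dot_lmul_matrix inner_flatten flip: D(2))
  ultimately show ?thesis by simp
qed

lemma full_gradient_lipschitz:
  assumes Y: "C2_function Y" and S: "convex \<Omega>" "x \<in> \<Omega>" "y \<in> \<Omega>"
    and V: "Y ` \<Omega> \<subseteq> V" and pos: "B0 \<ge> 0" "L \<ge> 0" "B1 \<ge> 0"
    and A1: "\<And>X. X \<in> V \<Longrightarrow> norm (gradient F X) \<le> B0"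
    and A2: "\<And>X X'. X \<in> V \<Longrightarrow> X' \<in> V \<Longrightarrow> norm (gradient F X - gradient F X') \<le> L * norm (X - X')"
    and A3: "\<And>\<theta>. \<theta> \<in> \<Omega> \<Longrightarrow> norm (full_jacobian Y \<theta>) \<le> B1"
    and A4: "\<And>\<theta>. \<theta> \<in> \<Omega> \<Longrightarrow> norm (second_derivative Y \<theta>) \<le> B2"
  shows "norm (full_gradient F Y x - full_gradient F Y y) \<le> (L * B1\<^sup>2 + B0 * B2) * norm (x - y)"
proof -
  let ?g = "\<lambda>\<theta>. flatten (gradient F (Y \<theta>))" and ?J = "full_jacobian Y"
  have Y_lip: "norm (Y x - Y y) \<le> B1 * norm (x - y)"
  proof (rule lipschitz_of_derivative_bound[OF S])
    fix z assume z: "z \<in> \<Omega>"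
    obtain D where D: "(Y has_derivative D) (at z)" "\<And>h. flatten (D h) = ?J z *v h"
      using C2_function_has_derivative[OF Y] by blast
    have "norm (D h) \<le> B1 * norm h" for h
      using norm_matrix_vector_mult_le[of "?J z" h] mult_right_mono[OF A3[OF z], of "norm h"]
      by (simp flip: D(2))
    with D(1) show "\<exists>D. (Y has_derivative D) (at z) \<and> (\<forall>h. norm (D h) \<le> B1 * norm h)"
      by blast
  qed
  have J_lip: "norm (?J x - ?J y) \<le> B2 * norm (x - y)"
  proof (rule lipschitz_of_derivative_bound[OF S])
    fix z assume z: "z \<in> \<Omega>"
    obtain D where D: "(?J has_derivative D) (at z)"
      "\<And>h. norm (D h) \<le> norm (second_derivative Y z) * norm h"
      using full_jacobian_has_derivative[OF Y] by blast
    have "norm (D h) \<le> B2 * norm h" for h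
      using D(2)[of h] mult_right_mono[OF A4[OF z], of "norm h"] by simp
    with D(1) show "\<exists>D. (?J has_derivative D) (at z) \<and> (\<forall>h. norm (D h) \<le> B2 * norm h)"
      by blast
  qed
  \<comment> \<open>Product-rule splitting: varying the output gradient contributes
    \<open>L * B1\<^sup>2\<close>, one \<open>B1\<close> coming from the Lipschitz constant of
    \<open>Y\<close>; varying the Jacobian contributes \<open>B0 * B2\<close>.\<close>
  have "full_gradient F Y x - full_gradient F Y y = (?g x - ?g y) v* ?J x + ?g y v* (?J x - ?J y)"
    by (simp add: full_gradient_def algebra_simps)
  also have "norm \<dots> \<le> norm (?g x - ?g y) * norm (?J x) + norm (?g y) * norm (?J x - ?J y)"
    by (meson norm_triangle_le add_mono norm_vector_matrix_mult_le)
  also have "\<dots> \<le> (L * (B1 * norm (x - y))) * B1 + B0 * (B2 * norm (x - y))"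
  proof -
    have V': "Y x \<in> V" "Y y \<in> V"
      using S V by auto
    have "norm (?g x - ?g y) \<le> L * (B1 * norm (x - y))"
      using A2[OF V'] mult_left_mono[OF Y_lip pos(2)] by (simp flip: flatten_diff)
    moreover have "norm (?g y) \<le> B0"
      using A1[OF V'(2)] by simp
    ultimately show ?thesis
      using pos S A3 J_lip by (intro add_mono mult_mono) auto
  qed
  finally show ?thesis
    by (simp add: power2_eq_square algebra_simps)
qed

text \<open>Selecting a batch amounts to zeroing the other rows of the output gradient. This gives
  both the full gradient for \<open>UNIV\<close> and a norm bound uniform in
  \<open>S\<close>.\<close>

lemma batch_gradient_eq:
  "batch_gradient F Y S \<theta> =
    flatten (\<chi> n. if n \<in> S then gradient F (Y \<theta>) $ n else 0) v* full_jacobian Y \<theta>"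
proof -
  have "batch_gradient F Y S \<theta> \<bullet> h =
    (flatten (\<chi> n. if n \<in> S then gradient F (Y \<theta>) $ n else 0) v* full_jacobian Y \<theta>) \<bullet> h" for h
  proof -
    define Z :: "real^'b^'c" where "Z = (\<chi> n. row_jacobian Y n \<theta> *v h)"
    have Z: "full_jacobian Y \<theta> *v h = flatten Z"
      by (simp add: Z_def flatten_def full_jacobian_def vec_eq_iff matrix_vector_mul_component)
    have "batch_gradient F Y S \<theta> \<bullet> h = (\<Sum>n\<in>S. gradient F (Y \<theta>) $ n \<bullet> Z $ n)"
      by (simp add: batch_gradient_def inner_sum_left dot_lmul_matrix Z_def)
    also have "\<dots> = (\<Sum>n\<in>UNIV. (if n \<in> S then gradient F (Y \<theta>) $ n else 0) \<bullet> Z $ n)"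
      by (rule sum.mono_neutral_cong_left) auto
    also have "\<dots> = (\<chi> n. if n \<in> S then gradient F (Y \<theta>) $ n else 0) \<bullet> Z"
      by (simp add: inner_vec_def)
    finally show ?thesis
      by (simp add: dot_lmul_matrix Z inner_flatten)
  qed
  then show ?thesis
    by (rule vector_eq_rdot[THEN iffD1, OF allI])
qed

lemma batch_gradient_UNIV: "batch_gradient F Y UNIV \<theta> = full_gradient F Y \<theta>"
  by (simp add: batch_gradient_eq full_gradient_def)

lemma norm_batch_gradient_le:
  "norm (batch_gradient F Y S \<theta>) \<le> norm (gradient F (Y \<theta>)) * norm (full_jacobian Y \<theta>)"
proof -
  have "norm (\<chi> n. if n \<in> S then gradient F (Y \<theta>) $ n else 0) \<le> norm (gradient F (Y \<theta>))"
    by (rule norm_le_componentwise_cart) auto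
  then show ?thesis
    unfolding batch_gradient_eq
    by (intro order_trans[OF norm_vector_matrix_mult_le] mult_right_mono) auto
qed


section \<open>Expectations over the batches\<close>

text \<open>The two sides may live on different sample spaces, which allows the recursion to be
  rerun on batch histories.\<close>

lemma sgd_iterate_cong:
  assumes "\<And>i. i < k \<Longrightarrow> \<B> i \<omega> = \<B>' i \<omega>'"
  shows "sgd_iterate F Y \<eta> \<theta>0 \<B> k \<omega> = sgd_iterate F Y \<eta> \<theta>0 \<B>' k \<omega>'"
  using assms by (induction k) auto

text \<open>
  Batches take values in a finite set, so the history up to any step has finite range and every
  function of it is measurable and bounded.
\<close>

lemma (in prob_space) integrable_history:
  fixes X :: "nat \<Rightarrow> 'a \<Rightarrow> 'b::finite" and f :: "(nat \<Rightarrow> 'b) \<Rightarrow> real"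
  assumes "\<And>i. random_variable (count_space UNIV) (X i)"
  shows "integrable M (\<lambda>\<omega>. f (restrict (\<lambda>i. X i \<omega>) {..<k}))"
proof -
  let ?P = "PiE {..<k} (\<lambda>_. UNIV :: 'b set)"
  have P: "finite ?P"
    by (intro finite_PiE) auto
  have "(\<lambda>\<omega>. restrict (\<lambda>i. X i \<omega>) {..<k}) \<in> measurable M (PiM {..<k} (\<lambda>_. count_space UNIV))"
    using assms by (intro measurable_restrict)
  \<comment> \<open>A finite product of discrete finite spaces is discrete, so \<open>f\<close> is
    automatically measurable on it.\<close>
  then have "(\<lambda>\<omega>. restrict (\<lambda>i. X i \<omega>) {..<k}) \<in> measurable M (count_space ?P)"
    by (simp add: count_space_PiM_finite)
  then have "(\<lambda>\<omega>. f (restrict (\<lambda>i. X i \<omega>) {..<k})) \<in> borel_measurable M"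
    by (rule measurable_compose) simp
  moreover have "norm (f (restrict (\<lambda>i. X i \<omega>) {..<k})) \<le> Max ((\<lambda>h. norm (f h)) ` ?P)" for \<omega>
    using P by (intro Max_ge) auto
  ultimately show ?thesis
    by (intro integrable_const_bound[where B = "Max ((\<lambda>h. norm (f h)) ` ?P)"]) auto
qed

text \<open>The history before \<open>k\<close> and the value at \<open>k\<close> involve the
  disjoint index sets \<open>{..<k}\<close> and \<open>{k}\<close>, so functions of them are
  independent.\<close>

lemma (in prob_space) expectation_history_mult:
  fixes X :: "nat \<Rightarrow> 'a \<Rightarrow> 'b::finite" and f :: "(nat \<Rightarrow> 'b) \<Rightarrow> real" and u :: "'b \<Rightarrow> real"
  assumes ind: "indep_vars (\<lambda>_. count_space UNIV) X UNIV"
  shows "expectation (\<lambda>\<omega>. f (restrict (\<lambda>i. X i \<omega>) {..<k}) * u (X k \<omega>)) =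
    expectation (\<lambda>\<omega>. f (restrict (\<lambda>i. X i \<omega>) {..<k})) * expectation (\<lambda>\<omega>. u (X k \<omega>))"
    and "integrable M (\<lambda>\<omega>. f (restrict (\<lambda>i. X i \<omega>) {..<k}) * u (X k \<omega>))"
proof -
  let ?H = "\<lambda>\<omega>. restrict (\<lambda>i. X i \<omega>) {..<k}"
  let ?K = "\<lambda>\<omega>. restrict (\<lambda>i. X i \<omega>) {k}"
  have rv: "random_variable (count_space UNIV) (X i)" for i
    using ind by (auto simp: indep_vars_def)
  have "indep_var (PiM {..<k} (\<lambda>_. count_space UNIV)) ?H (PiM {k} (\<lambda>_. count_space UNIV)) ?K"
    using ind by (rule indep_var_restrict) auto
  then have "indep_var borel (f \<circ> ?H) borel ((\<lambda>h. u (h k)) \<circ> ?K)"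
    by (rule indep_var_compose) (simp_all add: count_space_PiM_finite)
  then have I: "indep_var borel (\<lambda>\<omega>. f (?H \<omega>)) borel (\<lambda>\<omega>. u (X k \<omega>))"
    by (simp add: comp_def)
  have f: "integrable M (\<lambda>\<omega>. f (?H \<omega>))"
    by (rule integrable_history[OF rv])
  have u: "integrable M (\<lambda>\<omega>. u (X k \<omega>))"
    \<comment> \<open>The length is \<open>Suc k\<close> because the history must contain coordinate
      \<open>k\<close>.\<close>
    using integrable_history[of X "\<lambda>h. u (h k)" "Suc k", OF rv] by simp
  show "expectation (\<lambda>\<omega>. f (?H \<omega>) * u (X k \<omega>)) = expectation (\<lambda>\<omega>. f (?H \<omega>)) * expectation (\<lambda>\<omega>. u (X k \<omega>))"
    by (rule indep_var_lebesgue_integral[OF I f u])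
  show "integrable M (\<lambda>\<omega>. f (?H \<omega>) * u (X k \<omega>))"
    by (rule indep_var_integrable[OF I f u])
qed

context
  fixes M :: "'w measure" and b :: nat and \<B> :: "nat \<Rightarrow> 'w \<Rightarrow> 'n::finite set"
    and F :: "real^'d^'n \<Rightarrow> real" and Y :: "real^'s \<Rightarrow> real^'d^'n" and \<eta> :: real and \<theta>0 :: "real^'s"
  assumes M: "prob_space M" and batches: "random_batches M b \<B>"
begin

interpretation prob_space M by (rule M)

lemma indep_batches: "indep_vars (\<lambda>_. count_space UNIV) \<B> UNIV"
  using batches by (simp add: random_batches_def)

lemma sgd_iterate_history:
  obtains p where
    "\<And>\<omega>. sgd_iterate F Y \<eta> \<theta>0 \<B> k \<omega> = p (restrict (\<lambda>i. \<B> i \<omega>) {..<k})"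
proof
  \<comment> \<open>The witness is the same recursion with histories as sample points and coordinate
    projections as batches.\<close>
  show "sgd_iterate F Y \<eta> \<theta>0 \<B> k \<omega> =
      sgd_iterate F Y \<eta> \<theta>0 (\<lambda>i h. h i) k (restrict (\<lambda>i. \<B> i \<omega>) {..<k})" for \<omega>
    by (rule sgd_iterate_cong) simp
qed

lemma integrable_sgd_iterate:
  fixes f :: "real^'s \<Rightarrow> real"
  shows "integrable M (\<lambda>\<omega>. f (sgd_iterate F Y \<eta> \<theta>0 \<B> k \<omega>))"
proof -
  obtain p where p: "\<And>\<omega>. sgd_iterate F Y \<eta> \<theta>0 \<B> k \<omega> = p (restrict (\<lambda>i. \<B> i \<omega>) {..<k})"
    using sgd_iterate_history by blast
  show ?thesis
    unfolding p using indep_batches by (intro integrable_history) (auto simp: indep_vars_def)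
qed

text \<open>Unbiasedness up to the factor \<open>b/N\<close>: each coefficient depends only on the
  past, so it factors from the membership indicator of the current batch. Inside a batch only the
  marginal inclusion probabilities enter.\<close>

lemma expectation_batch_sum:
  fixes a :: "'n \<Rightarrow> real^'s \<Rightarrow> real"
  shows "expectation (\<lambda>\<omega>. \<Sum>n\<in>\<B> k \<omega>. a n (sgd_iterate F Y \<eta> \<theta>0 \<B> k \<omega>)) =
      real b / real CARD('n) * expectation (\<lambda>\<omega>. \<Sum>n\<in>UNIV. a n (sgd_iterate F Y \<eta> \<theta>0 \<B> k \<omega>))"
    and "integrable M (\<lambda>\<omega>. \<Sum>n\<in>\<B> k \<omega>. a n (sgd_iterate F Y \<eta> \<theta>0 \<B> k \<omega>))"
proof -
  let ?\<theta> = "sgd_iterate F Y \<eta> \<theta>0 \<B> k"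
  obtain p where p: "\<And>\<omega>. ?\<theta> \<omega> = p (restrict (\<lambda>i. \<B> i \<omega>) {..<k})"
    using sgd_iterate_history by blast
  \<comment> \<open>Indicators replace the random index set by a fixed one, so that sum and
    expectation can be exchanged.\<close>
  have eq: "(\<Sum>n\<in>\<B> k \<omega>. a n (?\<theta> \<omega>)) = (\<Sum>n\<in>UNIV. a n (?\<theta> \<omega>) * of_bool (n \<in> \<B> k \<omega>))" for \<omega>
    by (rule sum.mono_neutral_cong_left) auto
  have int: "integrable M (\<lambda>\<omega>. a n (?\<theta> \<omega>) * of_bool (n \<in> \<B> k \<omega>))" for n
    unfolding p by (rule expectation_history_mult(2)[OF indep_batches])
  have "random_variable (count_space UNIV) (\<B> k)"
    using indep_batches by (auto simp: indep_vars_def)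
  then have meas: "{\<omega> \<in> space M. n \<in> \<B> k \<omega>} \<in> events" for n
    by measurable
  have "expectation (\<lambda>\<omega>. of_bool (n \<in> \<B> k \<omega>)) = real b / real CARD('n)" for n
  proof -
    have "expectation (\<lambda>\<omega>. of_bool (n \<in> \<B> k \<omega>)) =
        expectation (\<lambda>\<omega>. indicator {\<omega> \<in> space M. n \<in> \<B> k \<omega>} \<omega>)"
      by (intro Bochner_Integration.integral_cong) (auto simp: indicator_def)
    also have "\<dots> = prob {\<omega> \<in> space M. n \<in> \<B> k \<omega>}"
      using meas by simp
    finally show ?thesis
      using batches by (simp add: random_batches_def)
  qed
  then have "expectation (\<lambda>\<omega>. a n (?\<theta> \<omega>) * of_bool (n \<in> \<B> k \<omega>)) =
      expectation (\<lambda>\<omega>. a n (?\<theta> \<omega>)) * (real b / real CARD('n))" for n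
    unfolding p by (subst expectation_history_mult(1)[OF indep_batches]) simp
  then have "expectation (\<lambda>\<omega>. \<Sum>n\<in>UNIV. a n (?\<theta> \<omega>) * of_bool (n \<in> \<B> k \<omega>)) =
      (\<Sum>n\<in>UNIV. expectation (\<lambda>\<omega>. a n (?\<theta> \<omega>)) * (real b / real CARD('n)))"
    by (subst Bochner_Integration.integral_sum[OF int]) (rule sum.cong[OF refl])
  also have "\<dots> = real b / real CARD('n) * expectation (\<lambda>\<omega>. \<Sum>n\<in>UNIV. a n (?\<theta> \<omega>))"
    by (subst Bochner_Integration.integral_sum[OF integrable_sgd_iterate])
      (simp add: sum_distrib_left mult.commute)
  finally show "expectation (\<lambda>\<omega>. \<Sum>n\<in>\<B> k \<omega>. a n (?\<theta> \<omega>)) =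
      real b / real CARD('n) * expectation (\<lambda>\<omega>. \<Sum>n\<in>UNIV. a n (?\<theta> \<omega>))"
    unfolding eq .
  show "integrable M (\<lambda>\<omega>. \<Sum>n\<in>\<B> k \<omega>. a n (?\<theta> \<omega>))"
    unfolding eq by (intro Bochner_Integration.integrable_sum int)
qed

end

section \<open>Geometric decay of the expected optimality gap\<close>

theorem theorem3p4:
  fixes Y :: "real^'s \<Rightarrow> real^'d^'n"
    and F :: "real^'d^'n \<Rightarrow> real"
    and \<Omega> :: "(real^'s) set"
    and V :: "(real^'d^'n) set"
    and Ystar :: "real^'d^'n"
    and \<theta>0 :: "real^'s"
    and M :: "'w measure"
    and \<B> :: "nat \<Rightarrow> 'w \<Rightarrow> 'n set"
    and b :: nat
    and r \<eta> B0 L B1 B2 lambda_min c_Y c2 c3 :: real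
  assumes Y_C2: "C2_function Y"
    and F_C1: "C1_function F"
    and Omega: "open \<Omega>" "convex \<Omega>"
    and V_ball: "r > 0" "V = ball Ystar r"
    and Y_Omega: "Y ` \<Omega> \<subseteq> V"
    and pos: "B0 > 0" "L > 0" "B1 > 0" "B2 > 0" "lambda_min > 0"
    and A1: "\<forall>X\<in>V. norm (gradient F X) \<le> B0"
    and A2: "\<forall>X\<in>V. \<forall>X'\<in>V. norm (gradient F X - gradient F X') \<le> L * norm (X - X')"
    and A3: "\<forall>\<theta>\<in>\<Omega>. norm (full_jacobian Y \<theta>) \<le> B1"
    and A4: "\<forall>\<theta>\<in>\<Omega>. norm (second_derivative Y \<theta>) \<le> B2"
    and A5: "\<forall>\<theta>\<in>\<Omega>. smallest_eigenvalue
               (full_jacobian Y \<theta> ** transpose (full_jacobian Y \<theta>)) \<ge> lambda_min"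
    and M: "prob_space M"
    and batches: "random_batches M b \<B>"
    and iterates: "AE \<omega> in M. \<forall>k. sgd_iterate F Y \<eta> \<theta>0 \<B> k \<omega> \<in> \<Omega>"
    and c_Y: "c_Y > 0"
    and strongly_convex: "\<forall>X\<in>V. \<forall>X'\<in>V.
          F X' \<ge> F X + gradient F X \<bullet> (X' - X) + c_Y / 2 * (norm (X' - X))\<^sup>2"
    and minimum: "\<forall>X\<in>V. F Ystar \<le> F X"
    and c2: "c2 = 1 / 2 * (L * B1\<^sup>2 + B0 * B2) * B1\<^sup>2"
    and c3: "c3 = real b / real CARD('n) * lambda_min - c2 * \<eta>"
    and eta: "\<eta> > 0"
      "\<eta> < min (real b / real CARD('n) * (lambda_min / c2)) (1 / (2 * c3 * c_Y))"
  shows "\<exists>C \<rho>. C > 0 \<and> \<rho> \<in> {0<..<1} \<and>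
    (\<forall>k. (\<integral>\<omega>. F (Y (sgd_iterate F Y \<eta> \<theta>0 \<B> k \<omega>)) \<partial>M) - F Ystar \<le> C * \<rho> ^ k)"
proof -
  interpret prob_space M by (rule M)
  let ?\<theta> = "sgd_iterate F Y \<eta> \<theta>0 \<B>" and ?\<Phi> = "\<lambda>\<theta>. F (Y \<theta>)"
  let ?g = "\<lambda>\<theta>. gradient F (Y \<theta>)"
  let ?p = "real b / real CARD('n)"
  \<comment> \<open>The share of sample \<open>n\<close> in the inner product of the full and batch
    gradients; it depends on \<theta> alone, as \<open>expectation_batch_sum\<close>
    requires.\<close>
  define a where "a n \<theta> = full_gradient F Y \<theta> \<bullet> (?g \<theta> $ n v* row_jacobian Y n \<theta>)" for n \<theta>
  define \<rho> where "\<rho> = 1 - 2 * \<eta> * c3 * c_Y"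
  have c2_pos: "c2 > 0"
    using pos by (simp add: c2 add_pos_pos)
  \<comment> \<open>The first bound on \<eta> gives \<open>c3 > 0\<close>, hence \<rho> < 1; the
    second gives \<rho> > 0.\<close>
  have c3_pos: "c3 > 0"
    using eta c2_pos by (simp add: c3 field_simps)
  have "2 * \<eta> * c3 * c_Y < 1"
    using eta c3_pos c_Y by (simp add: field_simps)
  then have \<rho>: "\<rho> \<in> {0<..<1}"
    using eta(1) c3_pos c_Y by (simp add: \<rho>_def)
  have a_sum: "(\<Sum>n\<in>S. a n \<theta>) = full_gradient F Y \<theta> \<bullet> batch_gradient F Y S \<theta>" for S \<theta>
    by (simp add: a_def batch_gradient_def inner_sum_right)
  \<comment> \<open>A deterministic bound for an arbitrary batch \<open>S\<close>. Both endpoints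
    must lie in \<Omega>, so that the Lipschitz estimate holds on the whole segment;
    \<open>c2\<close> is half the Lipschitz constant times the \<open>B1\<^sup>2\<close> from the
    batch gradient norm.\<close>
  have descent: "?\<Phi> (\<theta> - \<eta> *\<^sub>R batch_gradient F Y S \<theta>)
      \<le> ?\<Phi> \<theta> - \<eta> * (\<Sum>n\<in>S. a n \<theta>) + c2 * \<eta>\<^sup>2 * (norm (?g \<theta>))\<^sup>2"
    if \<theta>: "\<theta> \<in> \<Omega>" "\<theta> - \<eta> *\<^sub>R batch_gradient F Y S \<theta> \<in> \<Omega>" for \<theta> S
  proof -
    let ?G = "batch_gradient F Y S \<theta>" and ?K = "L * B1\<^sup>2 + B0 * B2"
    have "?\<Phi> (\<theta> - \<eta> *\<^sub>R ?G) \<le> ?\<Phi> \<theta> + full_gradient F Y \<theta> \<bullet> ((\<theta> - \<eta> *\<^sub>R ?G) - \<theta>)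
        + ?K / 2 * (norm ((\<theta> - \<eta> *\<^sub>R ?G) - \<theta>))\<^sup>2"
    proof (rule lipschitz_gradient_upper_bound[OF Omega(2) \<theta>])
      show "(?\<Phi> has_derivative (\<lambda>h. full_gradient F Y z \<bullet> h)) (at z)" for z
        by (rule compose_has_derivative[OF F_C1 Y_C2])
      show "norm (full_gradient F Y z - full_gradient F Y \<theta>) \<le> ?K * norm (z - \<theta>)" if "z \<in> \<Omega>" for z
        using Y_C2 Omega(2) that \<theta>(1) Y_Omega
        by (rule full_gradient_lipschitz) (use pos A1 A2 A3 A4 in auto)
    qed
    also have "\<dots> = ?\<Phi> \<theta> - \<eta> * (\<Sum>n\<in>S. a n \<theta>) + \<eta>\<^sup>2 * (?K / 2) * (norm ?G)\<^sup>2"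
      by (simp add: a_sum power_mult_distrib)
    also have "\<dots> \<le> ?\<Phi> \<theta> - \<eta> * (\<Sum>n\<in>S. a n \<theta>) + \<eta>\<^sup>2 * (?K / 2) * (norm (?g \<theta>) * B1)\<^sup>2"
    proof -
      have "norm ?G \<le> norm (?g \<theta>) * B1"
        using A3 \<theta>(1) by (intro order_trans[OF norm_batch_gradient_le] mult_left_mono) auto
      then show ?thesis
        using pos by (intro add_left_mono mult_left_mono power_mono) auto
    qed
    also have "\<dots> = ?\<Phi> \<theta> - \<eta> * (\<Sum>n\<in>S. a n \<theta>) + c2 * \<eta>\<^sup>2 * (norm (?g \<theta>))\<^sup>2"
      by (simp add: c2 power_mult_distrib)
    finally show ?thesis .
  qed
  \<comment> \<open>The left side is the descent bound with the batch sum replaced by its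
    conditional mean. The eigenvalue bound leaves a decrease of \<open>\<eta> * c3\<close> times the
    squared output gradient, which gradient domination converts into a multiple of the gap.\<close>
  have contraction: "?\<Phi> \<theta> - \<eta> * (?p * (\<Sum>n\<in>UNIV. a n \<theta>)) + c2 * \<eta>\<^sup>2 * (norm (?g \<theta>))\<^sup>2
      \<le> \<rho> * ?\<Phi> \<theta> + (1 - \<rho>) * F Ystar" if \<theta>: "\<theta> \<in> \<Omega>" for \<theta>
  proof -
    have "lambda_min * (norm (?g \<theta>))\<^sup>2 \<le> (norm (full_gradient F Y \<theta>))\<^sup>2"
      using smallest_eigenvalue_gram_le[of "full_jacobian Y \<theta>" "flatten (?g \<theta>)"] A5 \<theta>
        mult_right_mono[of lambda_min _ "(norm (?g \<theta>))\<^sup>2"]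
      unfolding full_gradient_def norm_flatten by (meson order_trans zero_le_power2)
    then have "\<eta> * (?p * (lambda_min * (norm (?g \<theta>))\<^sup>2)) \<le> \<eta> * (?p * (\<Sum>n\<in>UNIV. a n \<theta>))"
      using eta(1) unfolding a_sum batch_gradient_UNIV power2_norm_eq_inner
      by (intro mult_left_mono) auto
    moreover have "\<eta> * (?p * (lambda_min * (norm (?g \<theta>))\<^sup>2)) - c2 * \<eta>\<^sup>2 * (norm (?g \<theta>))\<^sup>2
        = \<eta> * c3 * (norm (?g \<theta>))\<^sup>2"
      by (simp add: c3 power2_eq_square algebra_simps)
    moreover have "\<eta> * c3 * (2 * c_Y * (?\<Phi> \<theta> - F Ystar)) \<le> \<eta> * c3 * (norm (?g \<theta>))\<^sup>2"
    proof (rule mult_left_mono)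
      have "Y \<theta> \<in> V" "Ystar \<in> V"
        using \<theta> Y_Omega V_ball by auto
      then show "2 * c_Y * (?\<Phi> \<theta> - F Ystar) \<le> (norm (?g \<theta>))\<^sup>2"
        using strongly_convex by (intro strongly_convex_imp_gradient_dominated[OF c_Y]) auto
    qed (use eta(1) c3_pos in auto)
    moreover have "\<rho> * ?\<Phi> \<theta> + (1 - \<rho>) * F Ystar = ?\<Phi> \<theta> - \<eta> * c3 * (2 * c_Y * (?\<Phi> \<theta> - F Ystar))"
      by (simp add: \<rho>_def algebra_simps)
    ultimately show ?thesis by linarith
  qed
  define e where "e k = expectation (\<lambda>\<omega>. ?\<Phi> (?\<theta> k \<omega>)) - F Ystar" for k
  have int: "integrable M (\<lambda>\<omega>. f (?\<theta> k \<omega>))" for f :: "real^'s \<Rightarrow> real" and k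
    by (rule integrable_sgd_iterate[OF M batches])
  have step: "e (Suc k) \<le> \<rho> * e k" for k
  proof -
    note int_S = expectation_batch_sum(2)[OF M batches, of a F Y \<eta> \<theta>0 k]
    have "expectation (\<lambda>\<omega>. ?\<Phi> (?\<theta> (Suc k) \<omega>))
        \<le> expectation (\<lambda>\<omega>. ?\<Phi> (?\<theta> k \<omega>) - \<eta> * (\<Sum>n\<in>\<B> k \<omega>. a n (?\<theta> k \<omega>))
            + c2 * \<eta>\<^sup>2 * (norm (?g (?\<theta> k \<omega>)))\<^sup>2)"
    proof (rule integral_mono_AE)
      show "AE \<omega> in M. ?\<Phi> (?\<theta> (Suc k) \<omega>) \<le> ?\<Phi> (?\<theta> k \<omega>) - \<eta> * (\<Sum>n\<in>\<B> k \<omega>. a n (?\<theta> k \<omega>))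
            + c2 * \<eta>\<^sup>2 * (norm (?g (?\<theta> k \<omega>)))\<^sup>2"
        using iterates
      proof eventually_elim
        case (elim \<omega>)
        then show ?case
          \<comment> \<open>Descent needs the iterates at \<open>k\<close> and at
            \<open>Suc k\<close> in \<Omega>, both available on the same almost sure event.\<close>
          using descent[of "?\<theta> k \<omega>" "\<B> k \<omega>"] elim[rule_format, of "Suc k"] by simp
      qed
      show "integrable M (\<lambda>\<omega>. ?\<Phi> (?\<theta> (Suc k) \<omega>))"
        by (rule int)
      show "integrable M (\<lambda>\<omega>. ?\<Phi> (?\<theta> k \<omega>) - \<eta> * (\<Sum>n\<in>\<B> k \<omega>. a n (?\<theta> k \<omega>))
            + c2 * \<eta>\<^sup>2 * (norm (?g (?\<theta> k \<omega>)))\<^sup>2)"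
        by (intro Bochner_Integration.integrable_add Bochner_Integration.integrable_diff
            integrable_mult_right int int_S)
    qed
    \<comment> \<open>Only the term linear in the batch gradient still depends on the current batch;
      averaging it yields the factor \<open>b/N\<close>.\<close>
    also have "\<dots> = expectation (\<lambda>\<omega>. ?\<Phi> (?\<theta> k \<omega>) - \<eta> * (?p * (\<Sum>n\<in>UNIV. a n (?\<theta> k \<omega>)))
            + c2 * \<eta>\<^sup>2 * (norm (?g (?\<theta> k \<omega>)))\<^sup>2)"
    proof -
      note i = int[of ?\<Phi> k] int[of "\<lambda>\<theta>. (norm (?g \<theta>))\<^sup>2" k] int[of "\<lambda>\<theta>. \<Sum>n\<in>UNIV. a n \<theta>" k]
      show ?thesis
        using i int_S expectation_batch_sum(1)[OF M batches, of a F Y \<eta> \<theta>0 k]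
        by (simp add: Bochner_Integration.integral_add Bochner_Integration.integral_diff
            del: Bochner_Integration.integral_sum)
    qed
    also have "\<dots> \<le> expectation (\<lambda>\<omega>. \<rho> * ?\<Phi> (?\<theta> k \<omega>) + (1 - \<rho>) * F Ystar)"
    proof (rule integral_mono_AE)
      show "AE \<omega> in M. ?\<Phi> (?\<theta> k \<omega>) - \<eta> * (?p * (\<Sum>n\<in>UNIV. a n (?\<theta> k \<omega>)))
            + c2 * \<eta>\<^sup>2 * (norm (?g (?\<theta> k \<omega>)))\<^sup>2 \<le> \<rho> * ?\<Phi> (?\<theta> k \<omega>) + (1 - \<rho>) * F Ystar"
        using iterates by eventually_elim (rule contraction, blast)
    qed (rule int)+
    also have "\<dots> = \<rho> * expectation (\<lambda>\<omega>. ?\<Phi> (?\<theta> k \<omega>)) + (1 - \<rho>) * F Ystar"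
      using int[of ?\<Phi> k] by (simp add: prob_space)
    finally show ?thesis
      by (simp add: e_def algebra_simps)
  qed
  \<comment> \<open>Adding 1 keeps the constant positive even when \<open>e 0 = 0\<close>.\<close>
  have "e k \<le> (\<bar>e 0\<bar> + 1) * \<rho> ^ k" for k
  proof (induction k)
    case (Suc k)
    have "e (Suc k) \<le> \<rho> * ((\<bar>e 0\<bar> + 1) * \<rho> ^ k)"
      by (rule order_trans[OF step mult_left_mono[OF Suc]]) (use \<rho> in auto)
    then show ?case by (simp add: mult_ac)
  qed simp
  then show ?thesis
    using \<rho> unfolding e_def
    by (intro exI[of _ "\<bar>e 0\<bar> + 1"] exI[of _ \<rho>]) (auto simp: e_def)
qed

end
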